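(* For every positive integer $m$ there exists a real number $c>0$ (depending on $m$) such that $$\frac{d^n}{dz^n}\Big((z+b)^{n-1}\ln \xi(z)\Big)\Big|_{z=1+b} > 0$$ for all integers $n$ with $1\le n\le m$ and all real $b\ge c$.
   Context: $\zeta$ is the Riemann zeta-function and $\xi(z)=\frac12 z(z-1)\pi^{-z/2}\Gamma(z/2)\zeta(z)$ is the Riemann xi-function (an entire function). For real $z>1$, $\xi(z)>0$, and $\ln\xi(z)$ denotes the branch of the logarithm which is real on the real half-line $z>1$ (it is analytic in a neighbourhood of each such point). *)

theory Defs
  imports "HOL-Complex_Analysis.Complex_Analysis"
begin

definition zeta_series :: "complex \<Rightarrow> complex" where
  "zeta_series s = (\<Sum>n. 1 / of_nat (Suc n) powr s)"

(* The Dirichlet series converges for Re s > 1; elsewhere zeta is its analytic continuation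
   to the plane punctured at 1, which exists classically and is unique by the identity theorem.
   The value at the pole is set to 0. *)
definition zeta :: "complex \<Rightarrow> complex" where
  "zeta s =
     (if Re s > 1 then zeta_series s
      else (THE f. f holomorphic_on - {1} \<and> f 1 = 0 \<and>
                   (\<forall>w. Re w > 1 \<longrightarrow> f w = zeta_series w)) s)"

(* The product has removable singularities at 1, 0, -2, -4, ..., where zeta or Gamma has a pole;
   in HOL these factors are 0 there, so the product itself would take spurious values.
   remove_sings fills in the limits, which yields the entire function. *)
definition xi :: "complex \<Rightarrow> complex" where
  "xi = remove_sings (\<lambda>z. 1 / 2 * z * (z - 1) * of_real pi powr (- z / 2) * Gamma (z / 2) * zeta z)"

(* For real z > 1 we have xi z > 0, so near each such point the principal branch Ln composed
   with xi is analytic and is the branch of log xi that is real on the half-line z > 1. *)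
definition ln_xi :: "complex \<Rightarrow> complex" where
  "ln_xi z = Ln (xi z)"

end

(* The n-th derivative expands by Leibniz' rule into terms (z + b)^(k-1) (ln xi)^(k)(z), 1 <= k <= n,
   with positive coefficients. Here ln xi(z) = ln Gamma(z/2 + 1) - (z/2) ln pi + ln((z - 1) zeta(z)).
   At z = 1 + b the term k = 1 is n! (ln xi)'(z), which tends to infinity like the digamma function.
   For k >= 2 the polygamma functions and, by Cauchy's estimate on discs of radius z/2, the
   derivatives of the logarithmic derivative of (z - 1) zeta(z) are O(z^(1-k)); as z + b < 2 z,
   these terms stay bounded. *)
theory Submission
  imports Defs
begin

section \<open>The zeta function on Re s > 2\<close>

lemma norm_zeta_term_le:
  assumes "Re s \<ge> 2"
  shows "norm (1 / of_nat (Suc n) powr s :: complex) \<le> 1 / (real n + 1)\<^sup>2"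
proof -
  have "(real n + 1)\<^sup>2 = (real n + 1) powr 2"
    by simp
  also have "\<dots> \<le> (real n + 1) powr Re s"
    using assms by (intro powr_mono) auto
  also have "\<dots> = norm (of_nat (Suc n) powr s)"
    by (subst norm_powr_real_powr) (auto simp: add.commute)
  finally show ?thesis
    by (simp add: norm_divide frac_le)
qed

lemma summable_zeta_bound: "summable (\<lambda>n. 1 / (real n + 1)\<^sup>2)"
  using inverse_squares_sums by (simp add: sums_iff add.commute)

lemma summable_zeta_series:
  assumes "Re s \<ge> 2"
  shows "summable (\<lambda>n. 1 / of_nat (Suc n) powr s :: complex)"
  by (rule summable_comparison_test[OF _ summable_zeta_bound])
     (use norm_zeta_term_le[OF assms] in blast)

text \<open>Without its leading term 1, the series is dominated by the sum of 1/n^2 over n >= 2,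
  which is pi^2/6 - 1. A bound below 1 keeps \<open>zeta\<close> away from 0.\<close>

lemma norm_zeta_minus_one_le:
  assumes "Re s \<ge> 2"
  shows "norm (zeta s - 1) \<le> 4 / 5"
proof -
  let ?f = "\<lambda>n. 1 / of_nat (Suc n) powr s :: complex"
  have "(\<lambda>n. 1 / (real (Suc n) + 1)\<^sup>2) sums (pi\<^sup>2 / 6 - 1)"
    using inverse_squares_sums sums_Suc_iff[of "\<lambda>n. 1 / (real n + 1)\<^sup>2" "pi\<^sup>2 / 6 - 1"]
    by (simp add: add.commute)
  moreover have "norm (\<Sum>n. ?f (Suc n)) \<le> (\<Sum>n. 1 / (real (Suc n) + 1)\<^sup>2)"
    using summable_zeta_bound norm_zeta_term_le[OF assms, of "Suc _"]
    by (intro norm_suminf_le summable_Suc_iff[THEN iffD2]) blast+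
  moreover have "(\<Sum>n. ?f (Suc n)) = zeta s - 1"
    using assms suminf_split_head[OF summable_zeta_series[OF assms]]
    by (simp add: zeta_def zeta_series_def)
  \<comment> \<open>This gives pi^2/6 - 1 <= 53/75 < 4/5.\<close>
  moreover have "pi\<^sup>2 \<le> (16 / 5)\<^sup>2"
    using pi_approx by (intro power_mono) auto
  ultimately show ?thesis
    by (simp add: sums_iff power2_eq_square)
qed

text \<open>Weierstrass M-test: on this half-plane the single majorant 1/(n+1)^2 serves all discs at
  once.\<close>

lemma zeta_holomorphic: "zeta holomorphic_on {s. Re s > 2}"
proof -
  let ?S = "{s. Re s > 2}"
  have op: "open ?S"
    by (rule open_halfspace_Re_gt)
  have "zeta_series holomorphic_on ?S"
  proof (rule holomorphic_uniform_sequence[OF op])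
    show "(\<lambda>s. \<Sum>i<n. 1 / of_nat (Suc i) powr s) holomorphic_on ?S" for n
      by (intro holomorphic_intros) auto
    fix s assume "s \<in> ?S"
    then obtain d where d: "d > 0" "cball s d \<subseteq> ?S"
      using op open_contains_cball by blast
    moreover have "uniform_limit (cball s d) (\<lambda>n s. \<Sum>i<n. 1 / of_nat (Suc i) powr s)
        zeta_series sequentially"
      unfolding zeta_series_def
    proof (rule Weierstrass_m_test[OF _ summable_zeta_bound])
      fix n z assume "z \<in> cball s d"
      then have "Re z > 2"
        using d by auto
      then show "norm (1 / of_nat (Suc n) powr z) \<le> 1 / (real n + 1)\<^sup>2"
        by (intro norm_zeta_term_le) simp
    qed
    ultimately show "\<exists>d>0. cball s d \<subseteq> ?S \<and>
        uniform_limit (cball s d) (\<lambda>n s. \<Sum>i<n. 1 / of_nat (Suc i) powr s) zeta_series sequentially"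
      by blast
  qed
  then show ?thesis
    by (rule holomorphic_transform) (auto simp: zeta_def)
qed

lemma zeta_of_real:
  assumes "x \<ge> 2"
  shows "zeta (of_real x) \<in> \<real>" "Re (zeta (of_real x)) > 0"
proof -
  have "zeta (of_real x) = (\<Sum>n. of_real (1 / real (Suc n) powr x))"
    using assms by (simp add: zeta_def zeta_series_def powr_of_real[symmetric])
  moreover have "summable (\<lambda>n. complex_of_real (1 / real (Suc n) powr x))"
    using summable_zeta_series[of "of_real x"] assms by (simp add: powr_of_real[symmetric])
  then have "summable (\<lambda>n. 1 / real (Suc n) powr x)"
    by (simp only: summable_complex_of_real)
  ultimately show "zeta (of_real x) \<in> \<real>"
    by (metis suminf_of_real Reals_of_real)
  show "Re (zeta (of_real x)) > 0"
    using norm_zeta_minus_one_le[of "of_real x"] assms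
      abs_Re_le_cmod[of "zeta (of_real x) - 1"] by simp
qed

section \<open>The logarithmic derivative of (z - 1) zeta(z)\<close>

definition logderiv_pole_zeta :: "complex \<Rightarrow> complex" where
  "logderiv_pole_zeta z = 1 / (z - 1) + deriv zeta z / zeta z"

lemma norm_zeta_bounds:
  assumes "Re s \<ge> 2"
  shows "norm (zeta s) \<ge> 1 / 5" "norm (zeta s) \<le> 2"
proof -
  show "norm (zeta s) \<ge> 1 / 5"
    using norm_zeta_minus_one_le[OF assms] norm_triangle_ineq2[of 1 "1 - zeta s"]
    by (simp add: norm_minus_commute)
  show "norm (zeta s) \<le> 2"
    using norm_zeta_minus_one_le[OF assms] norm_triangle_ineq2[of "zeta s" 1]
    by simp
qed

lemma logderiv_pole_zeta_holomorphic: "logderiv_pole_zeta holomorphic_on {s. Re s > 2}"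
proof -
  have "zeta s \<noteq> 0" if "Re s > 2" for s
    using norm_zeta_bounds(1)[of s] that by auto
  then show ?thesis
    unfolding logderiv_pole_zeta_def [abs_def]
    by (intro holomorphic_intros zeta_holomorphic open_halfspace_Re_gt) auto
qed

text \<open>The unit disc around s stays in Re > 2, where |zeta| <= 2, so Cauchy gives |zeta'(s)| <=
  2. With |zeta(s)| >= 1/5 the quotient is at most 10, and 1/(s - 1) adds at most 1.\<close>

lemma norm_logderiv_pole_zeta_le:
  assumes "Re s > 3"
  shows "norm (logderiv_pole_zeta s) \<le> 11"
proof -
  have sub: "cball s 1 \<subseteq> {s. Re s > 2}"
  proof
    fix z assume "z \<in> cball s 1"
    then show "z \<in> {s. Re s > 2}"
      using assms abs_Re_le_cmod[of "s - z"] by (auto simp: dist_norm)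
  qed
  have "norm ((deriv ^^ 1) zeta s) \<le> fact 1 * 2 / 1 ^ 1"
  proof (rule Cauchy_inequality)
    show "zeta holomorphic_on ball s 1"
      using zeta_holomorphic sub ball_subset_cball by (meson holomorphic_on_subset subset_trans)
    show "continuous_on (cball s 1) zeta"
      using zeta_holomorphic sub by (meson holomorphic_on_imp_continuous_on holomorphic_on_subset)
    fix z assume "norm (s - z) = 1"
    then have "z \<in> cball s 1"
      by (simp add: dist_norm)
    then show "norm (zeta z) \<le> 2"
      using sub by (intro norm_zeta_bounds) force
  qed simp
  moreover have "norm (zeta s) \<ge> 1 / 5"
    using assms by (intro norm_zeta_bounds) simp
  ultimately have "norm (deriv zeta s / zeta s) \<le> 2 / (1 / 5)"
    unfolding norm_divide by (intro frac_le) auto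
  moreover have "norm (s - 1) \<ge> 1"
    using assms complex_Re_le_cmod[of "s - 1"] by simp
  then have "norm (1 / (s - 1)) \<le> 1"
    by (simp add: norm_divide divide_simps)
  ultimately show ?thesis
    unfolding logderiv_pole_zeta_def
    using norm_triangle_ineq[of "1 / (s - 1)" "deriv zeta s / zeta s"] by simp
qed

text \<open>Cauchy's inequality on the disc of radius x/2: its points have real part at least x/2 >
  3, where the bound 11 holds. The radius grows with x, which yields the decay x^(-k).\<close>

lemma norm_higher_deriv_logderiv_pole_zeta_le:
  assumes "x > 6"
  shows "norm ((deriv ^^ k) logderiv_pole_zeta (of_real x)) \<le> fact k * 11 / (x / 2) ^ k"
proof (rule Cauchy_inequality)
  have sub: "cball (of_real x) (x / 2) \<subseteq> {s. Re s > 3}"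
  proof
    fix z :: complex assume "z \<in> cball (of_real x) (x / 2)"
    then show "z \<in> {s. Re s > 3}"
      using assms abs_Re_le_cmod[of "of_real x - z"] by (auto simp: dist_norm)
  qed
  have hol: "logderiv_pole_zeta holomorphic_on cball (of_real x) (x / 2)"
    by (rule holomorphic_on_subset[OF logderiv_pole_zeta_holomorphic]) (use sub in force)
  then show "logderiv_pole_zeta holomorphic_on ball (of_real x) (x / 2)"
    using ball_subset_cball holomorphic_on_subset by blast
  show "continuous_on (cball (of_real x) (x / 2)) logderiv_pole_zeta"
    using hol by (rule holomorphic_on_imp_continuous_on)
  show "norm (logderiv_pole_zeta z) \<le> 11" if "norm (of_real x - z) = x / 2" for z
    using that sub by (intro norm_logderiv_pole_zeta_le) (force simp: dist_norm)
qed (use assms in simp)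

section \<open>Polygamma functions on the positive real axis\<close>

text \<open>Start from 1/y^2 <= 1/(y(y - 1)) = 1/(y - 1) - 1/y, multiply by 1/y^(n-1), and enlarge
  that factor to 1/(y - 1)^(n-1) in the first term only.\<close>

lemma inverse_power_le_telescope:
  fixes y :: real
  assumes "y > 1" "n \<ge> 1"
  shows "inverse (y ^ Suc n) \<le> inverse ((y - 1) ^ n) - inverse (y ^ n)"
proof -
  obtain m where n: "n = Suc m"
    using assms by (cases n) auto
  have "inverse (y ^ Suc n) \<le> (inverse (y - 1) - inverse y) * inverse (y ^ m)"
  proof -
    have "inverse (y * y) \<le> inverse (y - 1) - inverse y"
      using assms by (simp add: field_simps)
    then have "inverse (y * y) * inverse (y ^ m) \<le> (inverse (y - 1) - inverse y) * inverse (y ^ m)"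
      using assms by (intro mult_right_mono) auto
    then show ?thesis
      by (simp add: n)
  qed
  also have "\<dots> = inverse (y - 1) * inverse (y ^ m) - inverse (y ^ n)"
    by (simp add: n algebra_simps)
  also have "inverse (y - 1) * inverse (y ^ m) \<le> inverse (y - 1) * inverse ((y - 1) ^ m)"
    using assms by (intro mult_left_mono le_imp_inverse_le power_mono) auto
  finally show ?thesis
    by (simp add: n)
qed

text \<open>Up to sign and the factor n!, \<open>Polygamma n (x + 1)\<close> is the sum of the
  positive terms 1/(x+1+k)^(n+1). They are dominated by differences telescoping to 1/x^n; the shift
  by 1 makes the telescope start at x.\<close>

lemma abs_Polygamma_real_le:
  fixes x :: real
  assumes "x > 0" "n \<ge> 1"
  shows "\<bar>Polygamma n (x + 1)\<bar> \<le> fact n / x ^ n"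
proof -
  let ?u = "\<lambda>k. inverse ((x + real k) ^ n)"
  have "?u \<longlonglongrightarrow> 0"
    using assms
    by (intro tendsto_inverse_0_at_top filterlim_pow_at_top filterlim_tendsto_add_at_top
        tendsto_const filterlim_real_sequentially) auto
  then have tel: "(\<lambda>k. ?u k - ?u (Suc k)) sums (?u 0 - 0)"
    by (rule telescope_sums')
  have pg: "(\<lambda>k. inverse ((x + 1 + real k) ^ Suc n)) sums ((-1) ^ Suc n * Polygamma n (x + 1) / fact n)"
    using assms Polygamma_LIMSEQ[of "x + 1" n] by simp
  have le: "(-1) ^ Suc n * Polygamma n (x + 1) / fact n \<le> ?u 0 - 0"
  proof (rule sums_le[OF _ pg tel])
    fix k
    show "inverse ((x + 1 + real k) ^ Suc n) \<le> ?u k - ?u (Suc k)"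
      using inverse_power_le_telescope[of "x + 1 + real k" n] assms by (simp add: add_ac)
  qed
  have "0 \<le> (-1) ^ Suc n * Polygamma n (x + 1) / fact n"
    using assms by (intro sums_le[OF _ sums_zero pg]) auto
  then have "\<bar>Polygamma n (x + 1)\<bar> / fact n = (-1) ^ Suc n * Polygamma n (x + 1) / fact n"
    using abs_of_nonneg by (fastforce simp: abs_mult power_abs)
  with le show ?thesis
    by (simp add: field_simps)
qed

text \<open>At positive integers the values are harmonic numbers minus Euler's constant, hence
  unbounded; monotonicity extends this to real arguments.\<close>

lemma Digamma_real_at_top: "filterlim (Digamma :: real \<Rightarrow> real) at_top at_top"
proof (subst filterlim_at_top, intro allI)
  fix Z :: real
  have "eventually (\<lambda>n. harm n \<ge> Z + euler_mascheroni) sequentially"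
    using harm_at_top by (simp add: filterlim_at_top)
  then obtain n where n: "harm n \<ge> Z + (euler_mascheroni :: real)"
    by (auto simp: eventually_sequentially)
  show "eventually (\<lambda>x. Z \<le> Digamma x) at_top"
    using eventually_ge_at_top[of "real (Suc n)"]
  proof eventually_elim
    case (elim x)
    then have "Digamma (real (Suc n)) \<le> Digamma x"
      by (intro Digamma_real_mono) auto
    with n show ?case
      by (simp only: Digamma_of_nat)
  qed
qed

section \<open>Explicit derivatives of xi'/xi and their size\<close>

text \<open>The k-th derivative of xi'/xi, thus the (k+1)-st of ln xi. The factor z/2 of xi is
  absorbed into Gamma(z/2 + 1), and the constant from the power of pi survives only for k =
  0.\<close>

definition xi_logderiv :: "nat \<Rightarrow> complex \<Rightarrow> complex" where
  "xi_logderiv k z = (1 / 2) ^ Suc k * Polygamma k (z / 2 + 1)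
     - (if k = 0 then of_real (ln pi) / 2 else 0) + (deriv ^^ k) logderiv_pole_zeta z"

lemma not_nonpos_Ints_if_Re_pos: "Re z > 0 \<Longrightarrow> z \<notin> \<int>\<^sub>\<le>\<^sub>0"
  by (auto elim!: nonpos_Ints_cases)

lemma has_field_derivative_xi_logderiv:
  assumes "Re z > 2"
  shows "(xi_logderiv k has_field_derivative xi_logderiv (Suc k) z) (at z)"
proof -
  have "z / 2 + 1 \<notin> \<int>\<^sub>\<le>\<^sub>0"
    using assms by (intro not_nonpos_Ints_if_Re_pos) simp
  moreover have "((deriv ^^ k) logderiv_pole_zeta has_field_derivative
      (deriv ^^ Suc k) logderiv_pole_zeta z) (at z)"
    using assms by (intro has_field_derivative_higher_deriv[OF logderiv_pole_zeta_holomorphic]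
        open_halfspace_Re_gt) auto
  ultimately show ?thesis
    unfolding xi_logderiv_def [abs_def]
    by (cases "k = 0") (auto intro!: derivative_eq_intros)
qed

text \<open>Openness of \<open>S\<close> turns the induction hypothesis into equality on a
  neighbourhood, which may then be differentiated.\<close>

lemma higher_deriv_eq_if_has_field_derivative:
  assumes "open S" "\<And>k z. z \<in> S \<Longrightarrow> (F k has_field_derivative F (Suc k) z) (at z)" "z \<in> S"
  shows "(deriv ^^ k) (F 0) z = F k z"
  using \<open>z \<in> S\<close>
proof (induction k arbitrary: z)
  case (Suc k)
  have "eventually (\<lambda>w. w \<in> S) (nhds z)"
    using Suc.prems assms(1) by (simp add: eventually_nhds_in_open)
  then have "eventually (\<lambda>w. (deriv ^^ k) (F 0) w = F k w) (nhds z)"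
    by eventually_elim (rule Suc.IH)
  then have "deriv ((deriv ^^ k) (F 0)) z = deriv (F k) z"
    by (intro deriv_cong_ev) auto
  then show ?case
    using assms(2)[OF Suc.prems] by (simp add: DERIV_imp_deriv)
qed simp

text \<open>The polygamma and zeta parts decay on the same scale, with constants 1 and 11. The
  condition k >= 1 excludes the growing digamma term and the constant with ln pi.\<close>

lemma norm_xi_logderiv_le:
  assumes "x > 6" "k \<ge> 1"
  shows "norm (xi_logderiv k (of_real x)) \<le> 12 * fact k / (x / 2) ^ k"
proof -
  have "Polygamma k (of_real x / 2 + 1) = complex_of_real (Polygamma k (x / 2 + 1))"
    using assms Polygamma_of_real[of "x / 2 + 1" k, where 'a = complex] by simp
  then have "norm (Polygamma k (of_real x / 2 + 1 :: complex)) \<le> fact k / (x / 2) ^ k"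
    using abs_Polygamma_real_le[of "x / 2" k] assms by simp
  moreover have "(1 / 2 :: real) ^ Suc k \<le> 1"
    by (intro power_le_one) auto
  ultimately have "(1 / 2) ^ Suc k * norm (Polygamma k (of_real x / 2 + 1 :: complex)) \<le>
      1 * (fact k / (x / 2) ^ k)"
    by (intro mult_mono) auto
  then have "norm ((1 / 2) ^ Suc k * Polygamma k (of_real x / 2 + 1 :: complex)) \<le>
      fact k / (x / 2) ^ k"
    by (simp add: norm_mult norm_power norm_divide)
  moreover have "norm ((deriv ^^ k) logderiv_pole_zeta (of_real x)) \<le> fact k * 11 / (x / 2) ^ k"
    using assms by (intro norm_higher_deriv_logderiv_pole_zeta_le)
  moreover have "12 * fact k / (x / 2) ^ k = fact k / (x / 2) ^ k + fact k * 11 / (x / 2) ^ k"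
    by (simp add: add_divide_distrib [symmetric])
  ultimately show ?thesis
    using assms unfolding xi_logderiv_def
    by (auto intro: order_trans[OF norm_triangle_ineq])
qed

text \<open>Half the digamma function at x/2 + 1 is unbounded, while the zeta part costs at most 11
  and ln pi / 2 is constant.\<close>

lemma Re_xi_logderiv_0_at_top:
  "filterlim (\<lambda>x. Re (xi_logderiv 0 (of_real x))) at_top at_top"
proof (rule filterlim_at_top_mono)
  have "filterlim (\<lambda>x::real. 1 + x * (1 / 2)) at_top at_top"
    by (intro filterlim_tendsto_add_at_top[OF tendsto_const]
        filterlim_at_top_mult_tendsto_pos[OF tendsto_const] filterlim_ident) auto
  then have "filterlim (\<lambda>x::real. Digamma (1 + x * (1 / 2))) at_top at_top"
    by (rule filterlim_compose[OF Digamma_real_at_top])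
  then have "filterlim (\<lambda>x::real. - (ln pi / 2 + 11) + 1 / 2 * Digamma (1 + x * (1 / 2))) at_top at_top"
    by (intro filterlim_tendsto_add_at_top[OF tendsto_const]
        filterlim_tendsto_pos_mult_at_top[OF tendsto_const]) auto
  then show "filterlim (\<lambda>x::real. 1 / 2 * Digamma (x / 2 + 1) - ln pi / 2 - 11) at_top at_top"
    by (simp add: algebra_simps)
  show "eventually (\<lambda>x. 1 / 2 * Digamma (x / 2 + 1) - ln pi / 2 - 11
      \<le> Re (xi_logderiv 0 (of_real x))) at_top"
    using eventually_gt_at_top[of 3]
  proof eventually_elim
    case (elim x)
    have "Polygamma 0 (of_real x / 2 + 1) = complex_of_real (Digamma (x / 2 + 1))"
      using elim Polygamma_of_real[of "x / 2 + 1" 0, where 'a = complex] by simp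
    then show ?case
      using norm_logderiv_pole_zeta_le[of "of_real x"] elim
        abs_Re_le_cmod[of "logderiv_pole_zeta (of_real x)"]
      by (simp add: xi_logderiv_def)
  qed
qed


section \<open>The function xi and its logarithm on Re z > 2\<close>

text \<open>This repeats the expression under \<open>remove_sings\<close> in \<open>xi\<close>
  verbatim, so that the definition of \<open>xi\<close> can be folded to it.\<close>

definition xi_product :: "complex \<Rightarrow> complex" where
  "xi_product z = 1 / 2 * z * (z - 1) * of_real pi powr (- z / 2) * Gamma (z / 2) * zeta z"

text \<open>Product rule; on this half-plane z, z - 1 and \<open>zeta z\<close> are nonzero, so the
  derivative factors as the product times the sum of the logarithmic derivatives.\<close>

lemma has_field_derivative_xi_product:
  assumes "Re z > 2"
  shows "(xi_product has_field_derivative xi_product z * xi_logderiv 0 z) (at z)"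
proof -
  have nz: "z \<noteq> 0" "z - 1 \<noteq> 0" "zeta z \<noteq> 0"
    using assms norm_zeta_bounds(1)[of z] by auto
  have "z / 2 \<notin> \<int>\<^sub>\<le>\<^sub>0"
    using assms by (intro not_nonpos_Ints_if_Re_pos) simp
  then have Gamma: "((\<lambda>z. Gamma (z / 2)) has_field_derivative Gamma (z / 2) * (Digamma (z / 2) / 2)) (at z)"
    by (auto intro!: derivative_eq_intros)
  have zeta: "(zeta has_field_derivative deriv zeta z) (at z)"
    using assms by (intro holomorphic_derivI[OF zeta_holomorphic open_halfspace_Re_gt]) simp
  have "((\<lambda>z. exp (- z / 2 * of_real (ln pi))) has_field_derivative
      exp (- z / 2 * of_real (ln pi)) * (- of_real (ln pi) / 2)) (at z)"
    by (auto intro!: derivative_eq_intros)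
  then have powr: "((\<lambda>z. of_real pi powr (- z / 2)) has_field_derivative
      of_real pi powr (- z / 2) * (- of_real (ln pi) / 2)) (at z)"
    by (simp add: powr_def Ln_of_real)
  \<comment> \<open>Half of 2/z accounts for the logarithmic derivative 1/z of the factor z.\<close>
  have Digamma: "Digamma (z / 2 + 1) = Digamma (z / 2) + 2 / z"
    using nz Digamma_plus1[of "z / 2"] by simp
  have "(xi_product has_field_derivative
      ((1 / 2 * z + 1 / 2 * (z - 1)) * of_real pi powr (- z / 2) * Gamma (z / 2) * zeta z
       + 1 / 2 * z * (z - 1) * (of_real pi powr (- z / 2) * (- of_real (ln pi) / 2)) * Gamma (z / 2) * zeta z
       + 1 / 2 * z * (z - 1) * of_real pi powr (- z / 2) * (Gamma (z / 2) * (Digamma (z / 2) / 2)) * zeta z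
       + 1 / 2 * z * (z - 1) * of_real pi powr (- z / 2) * Gamma (z / 2) * deriv zeta z)) (at z)"
    unfolding xi_product_def [abs_def]
    by (rule derivative_eq_intros Gamma zeta powr refl)+ (simp add: algebra_simps)
  also have "(1 / 2 * z + 1 / 2 * (z - 1)) * of_real pi powr (- z / 2) * Gamma (z / 2) * zeta z
       + 1 / 2 * z * (z - 1) * (of_real pi powr (- z / 2) * (- of_real (ln pi) / 2)) * Gamma (z / 2) * zeta z
       + 1 / 2 * z * (z - 1) * of_real pi powr (- z / 2) * (Gamma (z / 2) * (Digamma (z / 2) / 2)) * zeta z
       + 1 / 2 * z * (z - 1) * of_real pi powr (- z / 2) * Gamma (z / 2) * deriv zeta z
     = xi_product z * (1 / z + 1 / (z - 1) - of_real (ln pi) / 2 + Digamma (z / 2) / 2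
         + deriv zeta z / zeta z)"
    unfolding xi_product_def using nz by (simp add: distrib_left right_diff_distrib) (simp add: field_simps)
  also have "1 / z + 1 / (z - 1) - of_real (ln pi) / 2 + Digamma (z / 2) / 2
      + deriv zeta z / zeta z = xi_logderiv 0 z"
    unfolding xi_logderiv_def logderiv_pole_zeta_def Digamma by (simp add: algebra_simps)
  finally show ?thesis .
qed

lemma xi_product_holomorphic: "xi_product holomorphic_on {z. Re z > 2}"
  using has_field_derivative_xi_product
  by (auto simp: holomorphic_on_open open_halfspace_Re_gt)

text \<open>The product is analytic at z, so \<open>remove_sings\<close> keeps its value
  there.\<close>

lemma xi_eq_xi_product:
  assumes "Re z > 2"
  shows "xi z = xi_product z"
proof -
  have "xi_product analytic_on {z. Re z > 2}"
    using xi_product_holomorphic by (simp add: analytic_on_open open_halfspace_Re_gt)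
  then have "xi_product analytic_on {z}"
    using assms by (auto intro: analytic_on_subset)
  then show ?thesis
    unfolding xi_def xi_product_def [abs_def, symmetric] by (rule remove_sings_at_analytic)
qed

lemma has_field_derivative_xi:
  assumes "Re z > 2"
  shows "(xi has_field_derivative xi z * xi_logderiv 0 z) (at z)"
proof -
  have "(xi has_field_derivative xi_product z * xi_logderiv 0 z) (at z)"
    by (rule has_field_derivative_transform_within_open
        [OF has_field_derivative_xi_product[OF assms] open_halfspace_Re_gt[of 2]])
      (use assms xi_eq_xi_product in auto)
  then show ?thesis
    by (simp add: xi_eq_xi_product assms)
qed

text \<open>Every factor of the product is real and positive. This keeps xi off the branch cut of
  \<open>Ln\<close> on the real half-line.\<close>

lemma xi_of_real:
  assumes "x > 2"
  obtains y where "y > 0" "xi (of_real x) = of_real y"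
proof -
  obtain u where u: "zeta (of_real x) = of_real u" "u > 0"
    using zeta_of_real[of x] assms by (auto elim: Reals_cases)
  have "xi (of_real x) = of_real (1 / 2 * x * (x - 1) * pi powr (- x / 2) * Gamma (x / 2) * u)"
    using assms u Gamma_complex_of_real[of "x / 2"] powr_of_real[of pi "- x / 2"]
    by (simp add: xi_eq_xi_product xi_product_def)
  moreover have "1 / 2 * x * (x - 1) * pi powr (- x / 2) * Gamma (x / 2) * u > 0"
    using assms u by (intro mult_pos_pos) auto
  ultimately show ?thesis
    using that by blast
qed

text \<open>An open set containing the reals above 2 on which xi avoids the branch cut, so that the
  chain rule applies to \<open>Ln\<close> composed with \<open>xi\<close>.\<close>

definition ln_xi_domain :: "complex set" where
  "ln_xi_domain = {z. Re z > 2 \<and> xi z \<notin> \<real>\<^sub>\<le>\<^sub>0}"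

lemma of_real_in_ln_xi_domain: "x > 2 \<Longrightarrow> of_real x \<in> ln_xi_domain"
  by (rule xi_of_real[of x]) (simp_all add: ln_xi_domain_def)

lemma ln_xi_of_real: "x > 2 \<Longrightarrow> ln_xi (of_real x) \<in> \<real>"
  by (erule xi_of_real) (simp add: ln_xi_def Ln_of_real)

lemma open_ln_xi_domain: "open ln_xi_domain"
proof -
  have "continuous_on {z. Re z > 2} xi"
    by (intro continuous_at_imp_continuous_on ballI DERIV_isCont[OF has_field_derivative_xi]) simp
  then have "open ({z. Re z > 2} \<inter> xi -` (- \<real>\<^sub>\<le>\<^sub>0))"
    by (intro continuous_open_preimage open_halfspace_Re_gt open_Compl closed_nonpos_Reals_complex)
  moreover have "{z. Re z > 2} \<inter> xi -` (- \<real>\<^sub>\<le>\<^sub>0) = ln_xi_domain"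
    by (auto simp: ln_xi_domain_def)
  ultimately show ?thesis
    by simp
qed

lemma has_field_derivative_ln_xi:
  assumes "z \<in> ln_xi_domain"
  shows "(ln_xi has_field_derivative xi_logderiv 0 z) (at z)"
proof -
  have "xi z \<notin> \<real>\<^sub>\<le>\<^sub>0" "Re z > 2" "xi z \<noteq> 0"
    using assms by (auto simp: ln_xi_domain_def)
  then show ?thesis
    unfolding ln_xi_def [abs_def]
    by (auto intro!: derivative_eq_intros has_field_derivative_xi)
qed

lemma ln_xi_holomorphic: "ln_xi holomorphic_on ln_xi_domain"
  using has_field_derivative_ln_xi by (auto simp: holomorphic_on_open open_ln_xi_domain)

text \<open>The first derivative is \<open>xi_logderiv 0\<close> on an open set; the remaining k
  derivatives climb the family \<open>xi_logderiv\<close>.\<close>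

lemma higher_deriv_ln_xi:
  assumes "z \<in> ln_xi_domain"
  shows "(deriv ^^ Suc k) ln_xi z = xi_logderiv k z"
proof -
  have "eventually (\<lambda>w. w \<in> ln_xi_domain) (nhds z)"
    using assms open_ln_xi_domain by (simp add: eventually_nhds_in_open)
  then have "eventually (\<lambda>w. deriv ln_xi w = xi_logderiv 0 w) (nhds z)"
    by eventually_elim (intro DERIV_imp_deriv has_field_derivative_ln_xi)
  then have "(deriv ^^ k) (deriv ln_xi) z = (deriv ^^ k) (xi_logderiv 0) z"
    by (intro higher_deriv_cong_ev) auto
  also have "\<dots> = xi_logderiv k z"
    using assms
    by (intro higher_deriv_eq_if_has_field_derivative[OF open_halfspace_Re_gt[of 2]]
        has_field_derivative_xi_logderiv) (auto simp: ln_xi_domain_def)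
  finally show ?thesis
    by (simp add: funpow_Suc_right del: funpow.simps)
qed

section \<open>Real values of derivatives at real points\<close>

text \<open>Along the real line, Im f vanishes near x because the real trace of \<open>S\<close> is
  open, and its derivative there is the imaginary part of f'(x).\<close>

lemma deriv_of_real_in_Reals:
  assumes "f holomorphic_on S" "open S" "of_real x \<in> S"
    and real: "\<And>t. of_real t \<in> S \<Longrightarrow> f (of_real t) \<in> \<real>"
  shows "deriv f (of_real x) \<in> \<real>"
proof -
  have "(f has_field_derivative deriv f (of_real x)) (at (of_real x))"
    using assms by (intro holomorphic_derivI)
  then have "((\<lambda>t. f (of_real t)) has_vector_derivative deriv f (of_real x)) (at x)"
    by (rule has_vector_derivative_real_field)
  then have "((\<lambda>t. Im (f (of_real t))) has_vector_derivative Im (deriv f (of_real x))) (at x)"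
    by (rule bounded_linear.has_vector_derivative[OF bounded_linear_Im])
  moreover have "open (complex_of_real -` S)"
    using assms(2) by (intro open_vimage continuous_intros)
  ultimately have "((\<lambda>t. 0) has_vector_derivative Im (deriv f (of_real x))) (at x)"
    by (rule has_vector_derivative_transform_within_open)
       (use assms(3) real in \<open>auto simp: complex_is_Real_iff\<close>)
  then have "Im (deriv f (of_real x)) = 0"
    using vector_derivative_unique_at has_vector_derivative_const by blast
  then show ?thesis
    by (simp add: complex_is_Real_iff)
qed

lemma higher_deriv_of_real_in_Reals:
  assumes "f holomorphic_on S" "open S" "of_real x \<in> S"
    and "\<And>t. of_real t \<in> S \<Longrightarrow> f (of_real t) \<in> \<real>"
  shows "(deriv ^^ n) f (of_real x) \<in> \<real>"
  using assms(3)
proof (induction n arbitrary: x)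
  case (Suc n)
  then show ?case
    using assms(1,2) deriv_of_real_in_Reals[of "(deriv ^^ n) f" S x]
    by (simp add: holomorphic_higher_deriv)
qed (use assms in simp)

section \<open>Leibniz expansion and positivity\<close>

text \<open>Leibniz' rule; the Pochhammer factor is (n-1)!/(n-1-i)!, from differentiating the power
  i times. With k = n - 1 - i, each term pairs the k-th power with
  \<open>xi_logderiv k\<close>.\<close>

lemma higher_deriv_power_mult_ln_xi:
  assumes "z \<in> ln_xi_domain" "n \<ge> 1"
  shows "(deriv ^^ n) (\<lambda>z. (z + w) ^ (n - 1) * ln_xi z) z =
    (\<Sum>i<n. of_nat (n choose i) * pochhammer (of_nat (n - i)) i *
      (z + w) ^ (n - 1 - i) * xi_logderiv (n - 1 - i) z)"
proof -
  have pow: "(deriv ^^ i) (\<lambda>z. (z + w) ^ (n - 1)) z =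
      pochhammer (of_nat (n - i)) i * (z + w) ^ (n - 1 - i)" for i
    using higher_deriv_power[of i "- w" "n - 1" z] assms by simp
  have ln: "(deriv ^^ (n - i)) ln_xi z = xi_logderiv (n - 1 - i) z" if "i < n" for i
    using higher_deriv_ln_xi[OF assms(1), of "n - 1 - i"] that by (simp add: Suc_diff_Suc)
  have "(deriv ^^ n) (\<lambda>z. (z + w) ^ (n - 1) * ln_xi z) z =
      (\<Sum>i = 0..n. of_nat (n choose i) * (deriv ^^ i) (\<lambda>z. (z + w) ^ (n - 1)) z *
        (deriv ^^ (n - i)) ln_xi z)"
    using assms(1)
    by (intro higher_deriv_mult[OF _ ln_xi_holomorphic open_ln_xi_domain] holomorphic_intros)
  \<comment> \<open>The term i = n, the only one with ln xi undifferentiated, vanishes: the n-th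
    derivative of a power of degree n - 1 is 0, here as \<open>pochhammer 0 n\<close> with n >=
    1.\<close>
  also have "\<dots> = (\<Sum>i<n. of_nat (n choose i) * (deriv ^^ i) (\<lambda>z. (z + w) ^ (n - 1)) z *
        (deriv ^^ (n - i)) ln_xi z)"
  proof -
    have "{0..n} = insert n {..<n}"
      by auto
    then show ?thesis
      using assms(2) pow[of n] by (simp add: pochhammer_0_left)
  qed
  also have "\<dots> = (\<Sum>i<n. of_nat (n choose i) * pochhammer (of_nat (n - i)) i *
      (z + w) ^ (n - 1 - i) * xi_logderiv (n - 1 - i) z)"
    by (rule sum.cong[OF refl]) (simp only: pow ln mult.assoc lessThan_iff)
  finally show ?thesis .
qed

text \<open>At x = 1 + b the base z + b is 2 x - 1 < 2 x. Against the decay (x/2)^(-k) this leaves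
  4^k, independent of x.\<close>

lemma norm_power_mult_xi_logderiv_le:
  assumes "x > 6" "k \<ge> 1"
  shows "norm ((2 * of_real x - 1) ^ k * xi_logderiv k (of_real x)) \<le> 12 * fact k * 4 ^ k"
proof -
  have "norm (2 * of_real x - 1 :: complex) = 2 * x - 1"
    using assms norm_of_real[of "2 * x - 1", where 'a = complex] by simp
  then have "norm ((2 * of_real x - 1 :: complex) ^ k) \<le> (2 * x) ^ k"
    using assms unfolding norm_power by (intro power_mono) auto
  then have "norm ((2 * of_real x - 1) ^ k * xi_logderiv k (of_real x)) \<le>
      (2 * x) ^ k * (12 * fact k / (x / 2) ^ k)"
    unfolding norm_mult using assms by (intro mult_mono norm_xi_logderiv_le) auto
  also have "\<dots> = 12 * fact k * (2 * x / (x / 2)) ^ k"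
    unfolding power_divide by simp
  also have "2 * x / (x / 2) = 4"
    using assms by simp
  finally show ?thesis .
qed

theorem theorem5:
  fixes m :: nat
  assumes "m \<ge> 1"
  shows "\<exists>c::real. c > 0 \<and>
    (\<forall>n::nat. \<forall>b::real. 1 \<le> n \<and> n \<le> m \<and> b \<ge> c \<longrightarrow>
      (deriv ^^ n) (\<lambda>z::complex. (z + of_real b) ^ (n - 1) * ln_xi z) (of_real (1 + b)) \<in> \<real> \<and>
      Re ((deriv ^^ n) (\<lambda>z::complex. (z + of_real b) ^ (n - 1) * ln_xi z) (of_real (1 + b))) > 0)"
proof -
  define D where "D n b =
    (deriv ^^ n) (\<lambda>z::complex. (z + of_real b) ^ (n - 1) * ln_xi z) (of_real (1 + b))" for n b
  have real: "D n b \<in> \<real>" if "b > 1" for n b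
    unfolding D_def
  proof (rule higher_deriv_of_real_in_Reals)
    let ?S = "ln_xi_domain"
    show "open ?S"
      by (rule open_ln_xi_domain)
    show "(\<lambda>z. (z + of_real b) ^ (n - 1) * ln_xi z) holomorphic_on ?S"
      by (intro holomorphic_intros ln_xi_holomorphic)
    show "of_real (1 + b) \<in> ?S"
      using that by (intro of_real_in_ln_xi_domain) simp
    show "(of_real t + of_real b) ^ (n - 1) * ln_xi (of_real t) \<in> \<real>" if "of_real t \<in> ?S" for t
      using that by (intro Reals_mult Reals_power Reals_add Reals_of_real ln_xi_of_real)
        (simp add: ln_xi_domain_def)
  qed
  \<comment> \<open>Positivity is first shown for each fixed n, with a threshold for b that may
    depend on n.\<close>
  have pos: "eventually (\<lambda>b. Re (D n b) > 0) at_top" if n: "n \<ge> 1" for n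
  proof -
    define a where "a i = real (n choose i) * pochhammer (real (n - i)) i" for i
    \<comment> \<open>\<open>K\<close> bounds all terms except i = n - 1, uniformly in b; that last
      term carries \<open>xi_logderiv 0\<close>.\<close>
    define K where "K = (\<Sum>i<n - 1. a i * (12 * fact (n - 1 - i) * 4 ^ (n - 1 - i)))"
    have a_nonneg: "a i \<ge> 0" if "i < n" for i
      unfolding a_def using that by (intro mult_nonneg_nonneg pochhammer_nonneg) auto
    have "a (n - 1) = fact n"
      using n by (cases n) (simp_all add: a_def pochhammer_fact [symmetric])
    then have a_last: "a (n - 1) \<ge> 1"
      by simp
    have "filterlim (\<lambda>b. Re (xi_logderiv 0 (of_real (1 + b)))) at_top at_top"
      by (rule filterlim_compose[OF Re_xi_logderiv_0_at_top])
        (intro filterlim_tendsto_add_at_top[OF tendsto_const] filterlim_ident)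
    \<comment> \<open>Exceeding K beats the other terms; exceeding 0 allows the coefficient
      \<open>a (n - 1)\<close> to be bounded below by 1.\<close>
    then have "eventually (\<lambda>b. max K 0 < Re (xi_logderiv 0 (of_real (1 + b)))) at_top"
      unfolding filterlim_at_top_dense by blast
    then show ?thesis
      \<comment> \<open>This makes x = 1 + b exceed 6, as the bounds on the terms require.\<close>
      using eventually_gt_at_top[of 5]
    proof eventually_elim
      case (elim b)
      define x where "x = 1 + b"
      define t where "t i = of_real (a i) *
        ((2 * of_real x - 1) ^ (n - 1 - i) * xi_logderiv (n - 1 - i) (of_real x))" for i
      have "D n b = (\<Sum>i<n. of_nat (n choose i) * pochhammer (of_nat (n - i)) i *
          (of_real x + of_real b) ^ (n - 1 - i) * xi_logderiv (n - 1 - i) (of_real x))"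
        unfolding D_def x_def using n elim
        by (intro higher_deriv_power_mult_ln_xi of_real_in_ln_xi_domain) auto
      also have "of_real x + of_real b = (2 * of_real x - 1 :: complex)"
        by (simp add: x_def)
      also have "(\<Sum>i<n. of_nat (n choose i) * pochhammer (of_nat (n - i)) i *
          (2 * of_real x - 1) ^ (n - 1 - i) * xi_logderiv (n - 1 - i) (of_real x)) = (\<Sum>i<n. t i)"
        by (simp add: t_def a_def pochhammer_of_real [symmetric] mult.assoc)
      also have "\<dots> = (\<Sum>i<n - 1. t i) + t (n - 1)"
        using n sum.lessThan_Suc[of t "n - 1"] by simp
      finally have D: "Re (D n b) = Re (\<Sum>i<n - 1. t i) + a (n - 1) * Re (xi_logderiv 0 (of_real x))"
        by (simp add: t_def)
      have "norm (\<Sum>i<n - 1. t i) \<le> K"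
        unfolding K_def
      proof (rule sum_norm_le)
        fix i assume "i \<in> {..<n - 1}"
        then have i: "i < n" "n - 1 - i \<ge> 1"
          by auto
        have "norm (t i) =
            a i * norm ((2 * of_real x - 1) ^ (n - 1 - i) * xi_logderiv (n - 1 - i) (of_real x))"
          unfolding t_def norm_mult[of "of_real (a i)"] norm_of_real
          using a_nonneg[OF i(1)] by simp
        also have "\<dots> \<le> a i * (12 * fact (n - 1 - i) * 4 ^ (n - 1 - i))"
          using i elim
          by (intro mult_left_mono norm_power_mult_xi_logderiv_le a_nonneg) (auto simp: x_def)
        finally show "norm (t i) \<le> a i * (12 * fact (n - 1 - i) * 4 ^ (n - 1 - i))" .
      qed
      then have "Re (\<Sum>i<n - 1. t i) \<ge> - K"
        using abs_Re_le_cmod[of "\<Sum>i<n - 1. t i"] by linarith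
      moreover have "1 * Re (xi_logderiv 0 (of_real x)) \<le> a (n - 1) * Re (xi_logderiv 0 (of_real x))"
        using elim a_last by (intro mult_right_mono) (auto simp: x_def)
      moreover have "max K 0 < Re (xi_logderiv 0 (of_real x))"
        using elim by (simp add: x_def)
      ultimately show ?case
        using D by linarith
    qed
  qed
  \<comment> \<open>Only finitely many n occur, so one threshold serves them all.\<close>
  have "eventually (\<lambda>b. \<forall>n\<in>{1..m}. Re (D n b) > 0) at_top"
    using pos by (intro eventually_ball_finite) auto
  then obtain c where c: "\<And>b n. b \<ge> c \<Longrightarrow> n \<in> {1..m} \<Longrightarrow> Re (D n b) > 0"
    unfolding eventually_at_top_linorder by blast
  show ?thesis
    \<comment> \<open>The 2 makes the witness positive and ensures b > 1, as the claim
      \<open>real\<close> demands.\<close>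
    using c real unfolding D_def [symmetric] by (intro exI[of _ "max c 2"]) auto
qed

end
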